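(* Let $(B',d)$ be a metric space and $\iota:B\hookrightarrow B'$ the inclusion of a subset, correspondingly regarded as a metric space $(B,d)$ in its own right (with the restricted metric). For a function $f:B\to\mathbb{R}$, the following conditions (a)–(e) are all equivalent to their $\iota$-relative counterparts (a$^\iota$)–(e$^\iota$) (and all of these conditions are equivalent to one another); in each of (a)–(d) and (a$^\iota$)–(d$^\iota$) the version with "some" and the version with "all" are both included. (a) $f$ is the $\Phi$-boundary-limit of a continuous function $\overline{f}:B\times\mathbb{R}_{>0}\to\mathbb{R}$ for some (all) upper-bounded families $\Phi$ of gauges. (b) $f$ is the $\phi$-boundary-limit of a continuous function $\overline{f}:B\times\mathbb{R}_{>0}\to\mathbb{R}$ for some (all) gauges $\phi$. (c) $f$ is the $\Phi$-limit of a sequence of continuous functions $B\to\mathbb{R}$ for some (all) upper-bounded families $\Phi$ of gauges. (d) $f$ is the $\phi$-limit of a sequence of continuous functions $B\to\mathbb{R}$ for some (all) gauges $\phi$. (e) $f$ is Baire-1 on $(B,d)$. (a$^\iota$) $f$ is $\iota$-relatively the $\Phi$-boundary-limit of a continuous function $\overline{f}:B'\times\mathbb{R}_{>0}\to\mathbb{R}$ for some (all) upper-bounded families $\Phi$ of gauges. (b$^\iota$) $f$ is $\iota$-relatively the $\phi$-boundary-limit of a continuous function $\overline{f}:B'\times\mathbb{R}_{>0}\to\mathbb{R}$ for some (all) gauges $\phi$. (c$^\iota$) $f$ is $\iota$-relatively the $\Phi$-limit of a sequence of continuous functions $B'\to\mathbb{R}$ for some (all) upper-bounded families $\Phi$ of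 gauges. (d$^\iota$) $f$ is $\iota$-relatively the $\phi$-limit of a sequence of continuous functions $B'\to\mathbb{R}$ for some (all) gauges $\phi$. (e$^\iota$) $f$ is $\iota$-relatively Baire-1, i.e. there are continuous functions $f_n:B'\to\mathbb{R}$ with $f_n(b)\to f(b)$ for every $b\in B$.
   Context: **Gauges.** A (smallness) gauge is a germ at $0$ of continuous functions $\phi:[0,\varepsilon)\to\mathbb{R}_{\ge0}$ (some $\varepsilon>0$) with $\phi(0)=0$; two such functions define the same germ if they agree on some $[0,\varepsilon')$, $\varepsilon'>0$. Gauges are ordered by $\phi\le\phi'$ iff $\phi(x)\le\phi'(x)$ for all sufficiently small $x\ge0$. A family $\Phi$ of gauges is upper-bounded if some gauge $\phi'$ satisfies $\phi\le\phi'$ for all $\phi\in\Phi$. **$\iota$-relative limits.** Let $\Phi$ be a family of gauges. - $f:B\to\mathbb{R}$ is $\iota$-relatively the $\Phi$-boundary-limit of $\overline{f}:B'\times\mathbb{R}_{>0}\to\mathbb{R}$ if for every $b\in B$, $\phi\in\Phi$ and $\eta>0$ there is $\delta>0$ such that $|\overline{f}(b',t)-f(b)|<\eta$ whenever $0<t<\delta$ and $b'\in B'$ satisfies $d(b,b')\le\phi(t)$. - $f$ is $\iota$-relatively the $\Phi$-limit of a sequence $f_n:B'\to\mathbb{R}$ ($n\ge1$) if for every $b\in B$, $\phi\in\Phi$ and $\eta>0$ there is $N$ such that $|f_n(b')-f(b)|<\eta$ whenever $n\ge N$ and $b'\in B'$ satisfies $d(b,b')\le\phi(1/n)$. The absolute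 (non-relative) notions are the case $B'=B$. For a single gauge, "$\phi$-(boundary-)limit" means "$\{\phi\}$-(boundary-)limit". **Baire-1.** $f:B\to\mathbb{R}$ is Baire-1 if the preimage of every open set is $F_\sigma$ in $B$ (a countable union of closed sets). *)

theory Defs
  imports "HOL-Analysis.Analysis"
begin

text \<open>
  A representative is a total function \<open>real \<Rightarrow> real\<close> of which only the values on some
  \<open>[0,\<epsilon>)\<close> are constrained; two representatives are identified if they agree on some
  \<open>[0,\<epsilon>')\<close>.  The type of gauges consists of the resulting germs.
\<close>

definition gauge_rep :: "(real \<Rightarrow> real) \<Rightarrow> bool" where
  "gauge_rep \<phi> \<longleftrightarrow>
     (\<exists>\<epsilon>>0. continuous_on {0..<\<epsilon>} \<phi> \<and> (\<forall>x\<in>{0..<\<epsilon>}. 0 \<le> \<phi> x)) \<and> \<phi> 0 = 0"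

definition germ_eq :: "(real \<Rightarrow> real) \<Rightarrow> (real \<Rightarrow> real) \<Rightarrow> bool" where
  "germ_eq \<phi> \<psi> \<longleftrightarrow>
     gauge_rep \<phi> \<and> gauge_rep \<psi> \<and> (\<exists>\<epsilon>>0. \<forall>x\<in>{0..<\<epsilon>}. \<phi> x = \<psi> x)"

lemma germ_eq_part_equivp: "part_equivp germ_eq"
proof (rule part_equivpI)
  have "gauge_rep (\<lambda>x. 0)"
    unfolding gauge_rep_def by (auto intro!: exI[of _ 1])
  then show "\<exists>\<phi>. germ_eq \<phi> \<phi>"
    unfolding germ_eq_def by (auto intro!: exI[of _ "\<lambda>x. 0"] exI[of _ 1])
  show "symp germ_eq"
    unfolding symp_def germ_eq_def by metis
  show "transp germ_eq"
  proof (rule transpI)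
    fix \<phi> \<psi> \<rho> assume 1: "germ_eq \<phi> \<psi>" and 2: "germ_eq \<psi> \<rho>"
    obtain e1 where e1: "e1 > 0" "\<forall>x\<in>{0..<e1}. \<phi> x = \<psi> x"
      using 1 unfolding germ_eq_def by blast
    obtain e2 where e2: "e2 > 0" "\<forall>x\<in>{0..<e2}. \<psi> x = \<rho> x"
      using 2 unfolding germ_eq_def by blast
    have "\<forall>x\<in>{0..<min e1 e2}. \<phi> x = \<rho> x" using e1 e2 by auto
    moreover have "min e1 e2 > 0" using e1 e2 by auto
    ultimately show "germ_eq \<phi> \<rho>"
      using 1 2 unfolding germ_eq_def by blast
  qed
qed

quotient_type smallness_gauge = "real \<Rightarrow> real" / partial: germ_eq
  by (rule germ_eq_part_equivp)

lemma germ_le_respects: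
  assumes "germ_eq \<phi> \<phi>'" "germ_eq \<psi> \<psi>'" "\<exists>\<epsilon>>0. \<forall>x\<in>{0..<\<epsilon>}. \<phi> x \<le> \<psi> x"
  shows "\<exists>\<epsilon>>0. \<forall>x\<in>{0..<\<epsilon>}. \<phi>' x \<le> \<psi>' x"
proof -
  obtain e1 where e1: "e1 > 0" "\<forall>x\<in>{0..<e1}. \<phi> x = \<phi>' x"
    using assms(1) unfolding germ_eq_def by blast
  obtain e2 where e2: "e2 > 0" "\<forall>x\<in>{0..<e2}. \<psi> x = \<psi>' x"
    using assms(2) unfolding germ_eq_def by blast
  obtain e3 where e3: "e3 > 0" "\<forall>x\<in>{0..<e3}. \<phi> x \<le> \<psi> x"
    using assms(3) by blast
  have "\<phi>' x \<le> \<psi>' x" if "x \<in> {0..<min e1 (min e2 e3)}" for x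
  proof -
    have "x \<in> {0..<e1}" "x \<in> {0..<e2}" "x \<in> {0..<e3}"
      using that by simp_all
    then have "\<phi> x = \<phi>' x" "\<psi> x = \<psi>' x" "\<phi> x \<le> \<psi> x"
      using e1(2) e2(2) e3(2) by blast+
    then show ?thesis by simp
  qed
  moreover have "min e1 (min e2 e3) > 0" using e1 e2 e3 by auto
  ultimately show ?thesis by (intro exI[of _ "min e1 (min e2 e3)"]) blast
qed

lemma germ_eq_sym: "germ_eq \<phi> \<psi> \<Longrightarrow> germ_eq \<psi> \<phi>"
  unfolding germ_eq_def by metis

text \<open>With this order, the library's \<open>bdd_above\<close> expresses that a set of gauges is upper-bounded.\<close>

instantiation smallness_gauge :: order
begin

lift_definition less_eq_smallness_gauge :: "smallness_gauge \<Rightarrow> smallness_gauge \<Rightarrow> bool"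
  is "\<lambda>\<phi> \<psi>. \<exists>\<epsilon>>0. \<forall>x\<in>{0..<\<epsilon>}. \<phi> x \<le> \<psi> x"
  using germ_le_respects germ_eq_sym by blast

definition less_smallness_gauge :: "smallness_gauge \<Rightarrow> smallness_gauge \<Rightarrow> bool" where
  "less_smallness_gauge \<phi> \<psi> \<longleftrightarrow> \<phi> \<le> \<psi> \<and> \<not> \<psi> \<le> \<phi>"

instance
proof
  fix x y z :: smallness_gauge
  show "x < y \<longleftrightarrow> x \<le> y \<and> \<not> y \<le> x" by (rule less_smallness_gauge_def)
  show "x \<le> x" by transfer (auto intro: exI[of _ 1])
  show "x \<le> z" if "x \<le> y" "y \<le> z"
    using that
  proof transfer
    fix \<phi> \<psi> \<rho> :: "real \<Rightarrow> real"
    assume "\<exists>\<epsilon>>0. \<forall>x\<in>{0..<\<epsilon>}. \<phi> x \<le> \<psi> x" "\<exists>\<epsilon>>0. \<forall>x\<in>{0..<\<epsilon>}. \<psi> x \<le> \<rho> x"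
    then obtain e1 e2 where e: "e1 > 0" "e2 > 0"
      "\<forall>x\<in>{0..<e1}. \<phi> x \<le> \<psi> x" "\<forall>x\<in>{0..<e2}. \<psi> x \<le> \<rho> x" by blast
    have "\<phi> x \<le> \<rho> x" if "x \<in> {0..<min e1 e2}" for x
      using that e(3,4) by (intro order_trans[of "\<phi> x" "\<psi> x" "\<rho> x"]) simp_all
    moreover have "min e1 e2 > 0" using e by auto
    ultimately show "\<exists>\<epsilon>>0. \<forall>x\<in>{0..<\<epsilon>}. \<phi> x \<le> \<rho> x"
      by (intro exI[of _ "min e1 e2"]) blast
  qed
  show "x = y" if "x \<le> y" "y \<le> x"
    using that
  proof transfer
    fix \<phi> \<psi> :: "real \<Rightarrow> real"
    assume r: "germ_eq \<phi> \<phi>" "germ_eq \<psi> \<psi>"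
    assume "\<exists>\<epsilon>>0. \<forall>x\<in>{0..<\<epsilon>}. \<phi> x \<le> \<psi> x" "\<exists>\<epsilon>>0. \<forall>x\<in>{0..<\<epsilon>}. \<psi> x \<le> \<phi> x"
    then obtain e1 e2 where e: "e1 > 0" "e2 > 0"
      "\<forall>x\<in>{0..<e1}. \<phi> x \<le> \<psi> x" "\<forall>x\<in>{0..<e2}. \<psi> x \<le> \<phi> x" by blast
    have "\<forall>x\<in>{0..<min e1 e2}. \<phi> x = \<psi> x" using e by (simp add: order_antisym)
    moreover have "min e1 e2 > 0" using e by auto
    ultimately show "germ_eq \<phi> \<psi>" using r unfolding germ_eq_def by blast
  qed
qed

end

text \<open>
  Relative limits for a single gauge.  The carriers \<open>B \<subseteq> B'\<close> are subsets of a type of class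
  \<open>metric_space\<close>; the absolute notions are the instances \<open>B' = B\<close>.
  Neither definition depends on the choice of a representative.
\<close>

lift_definition gauge_boundary_limit ::
  "smallness_gauge \<Rightarrow> 'a::metric_space set \<Rightarrow> 'a set \<Rightarrow> ('a \<times> real \<Rightarrow> real) \<Rightarrow> ('a \<Rightarrow> real) \<Rightarrow> bool"
  is "\<lambda>\<phi> B B' F f. \<forall>b\<in>B. \<forall>\<eta>>0. \<exists>\<delta>>0. \<forall>t. 0 < t \<and> t < \<delta> \<longrightarrow>
        (\<forall>b'\<in>B'. dist b b' \<le> \<phi> t \<longrightarrow> \<bar>F (b', t) - f b\<bar> < \<eta>)"
proof -
  have *: "\<forall>b\<in>B. \<forall>\<eta>>0. \<exists>\<delta>>0. \<forall>t. 0 < t \<and> t < \<delta> \<longrightarrow>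
        (\<forall>b'\<in>B'. dist b b' \<le> \<psi> t \<longrightarrow> \<bar>F (b', t) - f b\<bar> < \<eta>)"
    if eq: "germ_eq \<phi> \<psi>"
      and lim: "\<forall>b\<in>B. \<forall>\<eta>>0. \<exists>\<delta>>0. \<forall>t. 0 < t \<and> t < \<delta> \<longrightarrow>
        (\<forall>b'\<in>B'. dist b b' \<le> \<phi> t \<longrightarrow> \<bar>F (b', t) - f b\<bar> < \<eta>)"
    for \<phi> \<psi> and B B' :: "'a set" and F :: "'a \<times> real \<Rightarrow> real" and f :: "'a \<Rightarrow> real"
  proof (intro ballI allI impI)
    fix b \<eta> assume "b \<in> B" "(\<eta>::real) > 0"
    then obtain \<delta> where \<delta>: "\<delta> > 0" "\<forall>t. 0 < t \<and> t < \<delta> \<longrightarrow>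
        (\<forall>b'\<in>B'. dist b b' \<le> \<phi> t \<longrightarrow> \<bar>F (b', t) - f b\<bar> < \<eta>)"
      using lim by blast
    obtain e where e: "e > 0" "\<forall>x\<in>{0..<e}. \<phi> x = \<psi> x"
      using eq unfolding germ_eq_def by blast
    show "\<exists>\<delta>>0. \<forall>t. 0 < t \<and> t < \<delta> \<longrightarrow>
        (\<forall>b'\<in>B'. dist b b' \<le> \<psi> t \<longrightarrow> \<bar>F (b', t) - f b\<bar> < \<eta>)"
      using \<delta> e by (intro exI[of _ "min \<delta> e"]) auto
  qed
  show "?thesis \<phi> \<psi>" if "germ_eq \<phi> \<psi>" for \<phi> \<psi>
    using *[OF that] *[OF germ_eq_sym[OF that]] by (intro ext iffI) 
qed

text \<open>Sequences are indexed by \<open>n \<ge> 1\<close>; the value at index \<open>0\<close> is irrelevant.\<close>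

lift_definition gauge_limit ::
  "smallness_gauge \<Rightarrow> 'a::metric_space set \<Rightarrow> 'a set \<Rightarrow> (nat \<Rightarrow> 'a \<Rightarrow> real) \<Rightarrow> ('a \<Rightarrow> real) \<Rightarrow> bool"
  is "\<lambda>\<phi> B B' F f. \<forall>b\<in>B. \<forall>\<eta>>0. \<exists>N\<ge>1. \<forall>n\<ge>N.
        (\<forall>b'\<in>B'. dist b b' \<le> \<phi> (1 / real n) \<longrightarrow> \<bar>F n b' - f b\<bar> < \<eta>)"
proof -
  have *: "\<forall>b\<in>B. \<forall>\<eta>>0. \<exists>N\<ge>1. \<forall>n\<ge>N.
        (\<forall>b'\<in>B'. dist b b' \<le> \<psi> (1 / real n) \<longrightarrow> \<bar>F n b' - f b\<bar> < \<eta>)"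
    if eq: "germ_eq \<phi> \<psi>"
      and lim: "\<forall>b\<in>B. \<forall>\<eta>>0. \<exists>N\<ge>1. \<forall>n\<ge>N.
        (\<forall>b'\<in>B'. dist b b' \<le> \<phi> (1 / real n) \<longrightarrow> \<bar>F n b' - f b\<bar> < \<eta>)"
    for \<phi> \<psi> and B B' :: "'a set" and F :: "nat \<Rightarrow> 'a \<Rightarrow> real" and f :: "'a \<Rightarrow> real"
  proof (intro ballI allI impI)
    fix b \<eta> assume "b \<in> B" "(\<eta>::real) > 0"
    then obtain N where N: "N \<ge> 1" "\<forall>n\<ge>N.
        (\<forall>b'\<in>B'. dist b b' \<le> \<phi> (1 / real n) \<longrightarrow> \<bar>F n b' - f b\<bar> < \<eta>)"
      using lim by blast
    obtain e where e: "e > 0" "\<forall>x\<in>{0..<e}. \<phi> x = \<psi> x"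
      using eq unfolding germ_eq_def by blast
    obtain M where M: "M > 0" "1 / real M < e"
      using e(1) nat_approx_posE[of e] by (metis zero_less_Suc)
    have "\<phi> (1 / real n) = \<psi> (1 / real n)" if "n \<ge> M" for n
    proof -
      have "1 / real n \<le> 1 / real M" using that M(1) by (simp add: frac_le)
      then show ?thesis using e(2) M(2) by auto
    qed
    then show "\<exists>N\<ge>1. \<forall>n\<ge>N.
        (\<forall>b'\<in>B'. dist b b' \<le> \<psi> (1 / real n) \<longrightarrow> \<bar>F n b' - f b\<bar> < \<eta>)"
      using N by (intro exI[of _ "max N M"]) auto
  qed
  show "?thesis \<phi> \<psi>" if "germ_eq \<phi> \<psi>" for \<phi> \<psi>
    using *[OF that] *[OF germ_eq_sym[OF that]] by (intro ext iffI)
qed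

definition family_boundary_limit ::
  "smallness_gauge set \<Rightarrow> 'a::metric_space set \<Rightarrow> 'a set \<Rightarrow> ('a \<times> real \<Rightarrow> real) \<Rightarrow> ('a \<Rightarrow> real) \<Rightarrow> bool"
where
  "family_boundary_limit \<Phi> B B' F f \<longleftrightarrow> (\<forall>\<phi>\<in>\<Phi>. gauge_boundary_limit \<phi> B B' F f)"

definition family_limit ::
  "smallness_gauge set \<Rightarrow> 'a::metric_space set \<Rightarrow> 'a set \<Rightarrow> (nat \<Rightarrow> 'a \<Rightarrow> real) \<Rightarrow> ('a \<Rightarrow> real) \<Rightarrow> bool"
where
  "family_limit \<Phi> B B' F f \<longleftrightarrow> (\<forall>\<phi>\<in>\<Phi>. gauge_limit \<phi> B B' F f)"

text \<open>
  Conditions on \<open>f\<close> for a fixed family; the approximating function or sequence may depend on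
  the family.
\<close>

definition continuous_boundary_limit ::
  "smallness_gauge set \<Rightarrow> 'a::metric_space set \<Rightarrow> 'a set \<Rightarrow> ('a \<Rightarrow> real) \<Rightarrow> bool" where
  "continuous_boundary_limit \<Phi> B B' f \<longleftrightarrow>
     (\<exists>F. continuous_on (B' \<times> {0<..}) F \<and> family_boundary_limit \<Phi> B B' F f)"

definition continuous_sequence_limit ::
  "smallness_gauge set \<Rightarrow> 'a::metric_space set \<Rightarrow> 'a set \<Rightarrow> ('a \<Rightarrow> real) \<Rightarrow> bool" where
  "continuous_sequence_limit \<Phi> B B' f \<longleftrightarrow>
     (\<exists>F. (\<forall>n\<ge>1. continuous_on B' (F n)) \<and> family_limit \<Phi> B B' F f)"

definition baire1_on :: "'a::metric_space set \<Rightarrow> ('a \<Rightarrow> real) \<Rightarrow> bool" where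
  "baire1_on B f \<longleftrightarrow> (\<forall>U. open U \<longrightarrow> fsigma_in (top_of_set B) {b\<in>B. f b \<in> U})"

definition relatively_baire1 :: "'a::metric_space set \<Rightarrow> 'a set \<Rightarrow> ('a \<Rightarrow> real) \<Rightarrow> bool" where
  "relatively_baire1 B B' f \<longleftrightarrow>
     (\<exists>F :: nat \<Rightarrow> 'a \<Rightarrow> real. (\<forall>n. continuous_on B' (F n)) \<and> (\<forall>b\<in>B. (\<lambda>n. F n b) \<longlonglongrightarrow> f b))"

text \<open>
  ``Some family'' must mean some nonempty family: every function is a limit with respect to
  the empty family.
\<close>

definition some_bounded_family :: "(smallness_gauge set \<Rightarrow> bool) \<Rightarrow> bool" where
  "some_bounded_family P \<longleftrightarrow> (\<exists>\<Phi>. \<Phi> \<noteq> {} \<and> bdd_above \<Phi> \<and> P \<Phi>)"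

definition all_bounded_families :: "(smallness_gauge set \<Rightarrow> bool) \<Rightarrow> bool" where
  "all_bounded_families P \<longleftrightarrow> (\<forall>\<Phi>. bdd_above \<Phi> \<longrightarrow> P \<Phi>)"

end

theory Submission
  imports Defs
begin

text \<open>
  The substance is that a Baire-1 function is a boundary limit on all of \<open>B'\<close>.
  For \<open>e > 0\<close>, cover \<open>B\<close> by nonempty sets \<open>A k\<close>, closed in \<open>B\<close>, on which \<open>f\<close> is within \<open>e\<close>
  of a constant \<open>v k\<close>, and average the \<open>v k\<close> with weights proportional to
  \<open>s ^ k * exp (- d(x, A k) / s)\<close>.  As \<open>s \<rightarrow> 0\<close> with \<open>d(b, x) \<le> s\<close>, the least \<open>k\<close> with
  \<open>b \<in> A k\<close> outweighs all others: smaller indices are suppressed by the exponential, larger ones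
  by the power of \<open>s\<close>.  A clamped uniform limit removes the error \<open>e\<close>.  A single function of
  \<open>(x, s)\<close> thus serves every gauge \<open>\<phi>\<close>, by substituting for \<open>s\<close> a positive continuous
  majorant of \<open>\<phi>\<close> that vanishes at \<open>0\<close>.
\<close>

section \<open>Uniform limits of clamped functions\<close>

text \<open>Uniform convergence on the whole type lets the limit in \<open>m\<close> be exchanged
  with the limit along each filter \<open>R b\<close>, although the convergence along
  \<open>R b\<close> need not be uniform in \<open>b\<close>.\<close>

lemma uniform_limit_of_limits:
  fixes G :: "nat \<Rightarrow> 'b::topological_space \<Rightarrow> real" and h :: "nat \<Rightarrow> 'c \<Rightarrow> real"
    and R :: "'c \<Rightarrow> 'b filter"
  assumes cont: "\<And>m. continuous_on S (G m)"
    and lim: "\<And>m b. b \<in> B \<Longrightarrow> (G m \<longlongrightarrow> h m b) (R b)"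
    and close: "\<And>m b. b \<in> B \<Longrightarrow> \<bar>h m b - f b\<bar> \<le> (1/2)^m"
  shows "\<exists>H. continuous_on S H \<and> (\<forall>b\<in>B. (H \<longlongrightarrow> f b) (R b))"
proof -
  \<comment> \<open>Clamping \<open>G (Suc m)\<close> to within \<open>2 * (1/2)^m\<close> of its predecessor makes the sequence uniformly
    convergent and does not change the limits, since those of \<open>h m\<close> already obey this bound.\<close>
  define H where "H = rec_nat (G 0) (\<lambda>m K p.
    max (K p - 2 * (1/2)^m) (min (G (Suc m) p) (K p + 2 * (1/2)^m)))"
  have H_0: "H 0 = G 0"
    and H_Suc: "H (Suc m) = (\<lambda>p. max (H m p - 2 * (1/2)^m) (min (G (Suc m) p) (H m p + 2 * (1/2)^m)))"
    for m
    by (simp_all add: H_def)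
  have step: "\<bar>H (Suc m) p - H m p\<bar> \<le> 2 * (1/2)^m" for m p
    by (auto simp: H_Suc max_def min_def)
  have H_cont: "continuous_on S (H m)" for m
    by (induction m) (auto simp: H_0 H_Suc intro!: continuous_intros cont)
  have H_lim: "(H m \<longlongrightarrow> h m b) (R b)" if b: "b \<in> B" for m b
  proof (induction m)
    case (Suc m)
    have "\<bar>h (Suc m) b - h m b\<bar> \<le> 2 * (1/2)^m"
      using close[OF b, of m] close[OF b, of "Suc m"] zero_le_power[of "1/2::real" m]
      unfolding power_Suc by linarith
    then have "h (Suc m) b = max (h m b - 2 * (1/2)^m) (min (h (Suc m) b) (h m b + 2 * (1/2)^m))"
      by (simp add: max_def min_def abs_le_iff)
    moreover have "(H (Suc m) \<longlongrightarrow> max (h m b - 2 * (1/2)^m)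
        (min (h (Suc m) b) (h m b + 2 * (1/2)^m))) (R b)"
      unfolding H_Suc by (intro tendsto_intros tendsto_max tendsto_min Suc lim b)
    ultimately show ?case by simp
  qed (simp add: H_0 lim b)
  have "uniform_limit UNIV (\<lambda>n p. \<Sum>i<n. H (Suc i) p - H i p)
      (\<lambda>p. \<Sum>i. H (Suc i) p - H i p) sequentially"
    using step by (intro Weierstrass_m_test[of _ _ "\<lambda>m. 2 * (1/2)^m"] summable_mult) auto
  from uniform_limit_add[OF uniform_limit_const[where c = "H 0"] this]
  obtain L where L: "uniform_limit UNIV H L sequentially"
    by (auto simp: sum_lessThan_telescope[of "\<lambda>i. H i _"])
  have "continuous_on S L"
    using H_cont by (intro uniform_limit_theorem[OF _ uniform_limit_on_subset[OF L]]) auto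
  moreover have "(L \<longlongrightarrow> f b) (R b)" if b: "b \<in> B" for b
  proof (rule swap_uniform_limit'[OF _ _ L])
    show "(\<lambda>m. h m b) \<longlonglongrightarrow> f b"
    proof (rule Lim_null_comparison[where g = "\<lambda>m. (1/2)^m", THEN LIM_zero_cancel])
      show "\<forall>\<^sub>F m in sequentially. norm (h m b - f b) \<le> (1/2)^m"
        using close[OF b] by simp
    qed (simp add: LIMSEQ_power_zero)
  qed (use H_lim[OF b] in auto)
  ultimately show ?thesis by blast
qed

section \<open>Approach to a boundary point within a cone\<close>

text \<open>Convergence to \<open>(b, 0)\<close> inside the cone \<open>dist b x \<le> s\<close>,
  \<open>s > 0\<close>, is packaged as a filter so that the limit calculus applies. The point
  \<open>x\<close> ranges over the whole type, which covers every carrier \<open>B'\<close> at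
  once.\<close>

definition vicinity :: "'a::metric_space \<Rightarrow> ('a \<times> real) filter" where
  "vicinity b = inf (principal {(x, s). dist b x \<le> s}) (filtercomap snd (at_right 0))"

lemma eventually_vicinity:
  "eventually P (vicinity b) \<longleftrightarrow>
     (\<exists>\<delta>>0. \<forall>s x. 0 < s \<and> s < \<delta> \<and> dist b x \<le> s \<longrightarrow> P (x, s))"
proof -
  have "eventually P (vicinity b) \<longleftrightarrow>
      (\<exists>Q. eventually Q (at_right 0) \<and> (\<forall>p. Q (snd p) \<longrightarrow> dist b (fst p) \<le> snd p \<longrightarrow> P p))"
    unfolding vicinity_def inf.commute[of "principal _"]
    by (simp add: eventually_inf_principal eventually_filtercomap case_prod_unfold)
  also have "\<dots> \<longleftrightarrow> (\<forall>\<^sub>F s in at_right 0. \<forall>x. dist b x \<le> s \<longrightarrow> P (x, s))"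
  proof
    assume "\<exists>Q. eventually Q (at_right 0) \<and> (\<forall>p. Q (snd p) \<longrightarrow> dist b (fst p) \<le> snd p \<longrightarrow> P p)"
    then obtain Q where "eventually Q (at_right 0)"
      and "\<And>p. Q (snd p) \<Longrightarrow> dist b (fst p) \<le> snd p \<Longrightarrow> P p"
      by blast
    then show "\<forall>\<^sub>F s in at_right 0. \<forall>x. dist b x \<le> s \<longrightarrow> P (x, s)"
      by (auto elim: eventually_mono)
  qed (intro exI[of _ "\<lambda>s. \<forall>x. dist b x \<le> s \<longrightarrow> P (x, s)"], simp)
  finally show ?thesis
    by (simp add: eventually_at_right_field) meson
qed

lemma filterlim_snd_vicinity: "filterlim snd (at_right 0) (vicinity b)"
  unfolding vicinity_def by (rule filterlim_mono[OF filterlim_filtercomap order_refl inf_le2])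

section \<open>Weighted averages over a sequence of sets\<close>

text \<open>
  The denominator only makes the series of \<open>weight A v k p\<close> and of \<open>weight A v k p * v k\<close> converge
  uniformly.
\<close>

definition weight :: "(nat \<Rightarrow> 'a::metric_space set) \<Rightarrow> (nat \<Rightarrow> real) \<Rightarrow> nat \<Rightarrow> 'a \<times> real \<Rightarrow> real" where
  "weight A v k p = snd p ^ k * exp (- infdist (fst p) (A k) / snd p) / (2 ^ k * (1 + \<bar>v k\<bar>))"

text \<open>The intended range is \<open>0 < snd p \<le> 1\<close>: both series converge there,
  while elsewhere \<open>suminf\<close> may be unspecified.\<close>

definition weighted_average ::
  "(nat \<Rightarrow> 'a::metric_space set) \<Rightarrow> (nat \<Rightarrow> real) \<Rightarrow> 'a \<times> real \<Rightarrow> real" where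
  "weighted_average A v p = (\<Sum>k. weight A v k p * v k) / (\<Sum>k. weight A v k p)"

lemma weight_pos: "snd p > 0 \<Longrightarrow> weight A v k p > 0"
  unfolding weight_def by (intro divide_pos_pos mult_pos_pos) auto

text \<open>The denominator of \<open>weight\<close> absorbs \<open>y\<close> and leaves a geometric
  factor. With \<open>E = 1\<close> this gives the bounds for uniform convergence, with small
  \<open>E\<close> the error estimate near the boundary.\<close>

lemma abs_weight_mult_le:
  assumes "snd p > 0" "\<bar>y\<bar> \<le> C * (1 + \<bar>v k\<bar>)" "snd p ^ k * exp (- infdist (fst p) (A k) / snd p) \<le> E"
  shows "\<bar>weight A v k p * y\<bar> \<le> C * E * (1/2)^k"
proof -
  have "\<bar>weight A v k p * y\<bar>
      = (snd p ^ k * exp (- infdist (fst p) (A k) / snd p)) * (\<bar>y\<bar> / (1 + \<bar>v k\<bar>)) * (1/2)^k"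
    using assms(1) by (simp add: weight_def abs_mult power_divide field_simps)
  also have "\<dots> \<le> E * C * (1/2)^k"
    using assms by (intro mult_right_mono mult_mono) (auto simp: pos_divide_le_eq intro: order_trans[rotated])
  finally show ?thesis by (simp add: mult.commute)
qed

lemma abs_weight_le:
  assumes "p \<in> UNIV \<times> {0<..1}"
  shows "\<bar>weight A v k p\<bar> \<le> (1/2)^k" "\<bar>weight A v k p * v k\<bar> \<le> (1/2)^k"
proof -
  have "snd p ^ k * exp (- infdist (fst p) (A k) / snd p) \<le> 1"
    using assms by (intro mult_le_one power_le_one) (auto simp: mem_Times_iff infdist_nonneg)
  then show "\<bar>weight A v k p\<bar> \<le> (1/2)^k" "\<bar>weight A v k p * v k\<bar> \<le> (1/2)^k"
    using assms abs_weight_mult_le[of p 1 1 v k A 1] abs_weight_mult_le[of p "v k" 1 v k A 1]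
    by (auto simp: mem_Times_iff)
qed

lemma summable_weight:
  assumes "p \<in> UNIV \<times> {0<..1}"
  shows "summable (\<lambda>k. weight A v k p)" "summable (\<lambda>k. weight A v k p * v k)"
  using abs_weight_le[OF assms]
  by (intro summable_comparison_test'[OF summable_geometric[of "1/2::real"], of 0]; simp)+

lemma suminf_weight_pos:
  assumes "p \<in> UNIV \<times> {0<..1}"
  shows "(\<Sum>k. weight A v k p) > 0"
  using assms by (intro suminf_pos summable_weight weight_pos) auto

lemma continuous_on_weighted_average:
  "continuous_on (UNIV \<times> {0<..1}) (weighted_average A v)"
proof -
  have c: "continuous_on (UNIV \<times> {0<..1}) (weight A v k)" for k
    unfolding weight_def by (intro continuous_intros) auto
  have "continuous_on (UNIV \<times> {0<..1}) (\<lambda>p. \<Sum>k. g k p)"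
    if "\<And>k. continuous_on (UNIV \<times> {0<..1}) (g k)"
      and "\<And>k p. p \<in> UNIV \<times> {0<..1} \<Longrightarrow> \<bar>g k p\<bar> \<le> (1/2)^k" for g :: "nat \<Rightarrow> 'a \<times> real \<Rightarrow> real"
    using that by (intro uniform_limit_theorem[OF _ Weierstrass_m_test[of _ _ "\<lambda>k. (1/2)^k"]]
      always_eventually allI continuous_on_sum summable_geometric) auto
  note this[of "weight A v"] this[of "\<lambda>k p. weight A v k p * v k"]
  then have "continuous_on (UNIV \<times> {0<..1}) (\<lambda>p. \<Sum>k. weight A v k p)"
    "continuous_on (UNIV \<times> {0<..1}) (\<lambda>p. \<Sum>k. weight A v k p * v k)"
    using c abs_weight_le by (blast intro: continuous_on_mult_right)+
  then show ?thesis
    unfolding weighted_average_def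
    by (intro continuous_on_divide ballI less_imp_neq[symmetric] suminf_weight_pos)
qed

text \<open>With \<open>u = 1 / s\<close>, \<open>exp (c * u)\<close> outgrows \<open>u ^ k\<close>.
  Hence exponentially suppressed weights lose against one of order \<open>s ^ k\<close>.\<close>

lemma exp_inverse_over_power_tendsto_0:
  assumes "c > 0"
  shows "((\<lambda>s::real. exp (- c / s) / s ^ k) \<longlongrightarrow> 0) (at_right 0)"
proof -
  have "((\<lambda>u. (c * u) ^ k / exp (c * u)) \<longlongrightarrow> 0) at_top"
    by (rule filterlim_compose[OF tendsto_power_div_exp_0])
      (intro filterlim_tendsto_pos_mult_at_top[OF tendsto_const assms filterlim_ident])
  from tendsto_mult_right_zero[OF this, of "inverse (c ^ k)"]
  have "((\<lambda>u. u ^ k / exp (c * u)) \<longlongrightarrow> 0) at_top"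
    using assms by (simp add: power_mult_distrib field_simps)
  from filterlim_compose[OF this filterlim_inverse_at_top_right]
  show ?thesis by (simp add: field_simps exp_minus)
qed

text \<open>In the cone and for small \<open>s\<close>, \<open>weight A v k\<^sub>0\<close> is at
  least a constant times \<open>s ^ k\<^sub>0\<close>. Up to constants, the weights with
  \<open>k < k\<^sub>0\<close> are at most \<open>exp (- (\<delta> / 2) / s)\<close> and those with
  \<open>k > k\<^sub>0\<close> at most \<open>s ^ Suc k\<^sub>0\<close>; divided by
  \<open>s ^ k\<^sub>0\<close>, both bounds vanish as \<open>s \<rightarrow> 0\<close>.\<close>

lemma weighted_average_tendsto:
  assumes "b \<in> A k\<^sub>0" and far: "\<And>k. k < k\<^sub>0 \<Longrightarrow> infdist b (A k) > 0"
  shows "(weighted_average A v \<longlongrightarrow> v k\<^sub>0) (vicinity b)"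
proof -
  \<comment> \<open>The inserted \<open>1\<close> keeps the set nonempty when
    \<open>k\<^sub>0 = 0\<close>.\<close>
  define \<delta> where "\<delta> = Min (insert 1 ((\<lambda>k. infdist b (A k)) ` {..<k\<^sub>0}))"
  have "\<delta> > 0" and \<delta>_le: "\<And>k. k < k\<^sub>0 \<Longrightarrow> \<delta> \<le> infdist b (A k)"
    using far by (auto simp: \<delta>_def)
  define V where "V = 1 + \<bar>v k\<^sub>0\<bar>"
  \<comment> \<open>The \<open>2\<close> is the sum of the geometric series, the first
    \<open>V\<close> bounds \<open>v k - v k\<^sub>0\<close> relative to \<open>1 + |v k|\<close>,
    and the bracket is the reciprocal of the constant in the lower bound \<open>W\<close>
    below.\<close>
  define C where "C = 2 * V * (exp 1 * 2 ^ k\<^sub>0 * V)"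
  have "V > 0" by (simp add: V_def)
  define err where "err s = s + exp (- (\<delta> / 2) / s) / s ^ k\<^sub>0" for s
  have bound: "\<bar>weighted_average A v (x, s) - v k\<^sub>0\<bar> \<le> C * err s"
    if s: "0 < s" "s < min 1 (\<delta> / 2)" and x: "dist b x \<le> s" for s x
  proof -
    let ?p = "(x, s)"
    let ?W = "\<Sum>k. weight A v k ?p"
    have p: "?p \<in> UNIV \<times> {0<..1}" using s by auto
    have err: "err s * s ^ k\<^sub>0 = s ^ Suc k\<^sub>0 + exp (- (\<delta> / 2) / s)"
      using s by (simp add: err_def field_simps)
    have "infdist x (A k\<^sub>0) \<le> s"
      using infdist_le[OF assms(1), of x] x by (simp add: dist_commute)
    then have "exp (- 1) \<le> exp (- infdist x (A k\<^sub>0) / s)"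
      using s by simp
    then have "s ^ k\<^sub>0 * exp (- 1) / (2 ^ k\<^sub>0 * V) \<le> weight A v k\<^sub>0 ?p"
      unfolding weight_def V_def using s by (intro divide_right_mono) auto
    also have "\<dots> \<le> ?W"
      using sum_le_suminf[OF summable_weight(1)[OF p], of "{k\<^sub>0}" A v] weight_pos[of ?p A v] s
      by (simp add: less_imp_le)
    finally have W: "s ^ k\<^sub>0 / (exp 1 * 2 ^ k\<^sub>0 * V) \<le> ?W"
      by (simp add: exp_minus field_simps)
    have term_le: "\<bar>weight A v k ?p * (v k - v k\<^sub>0)\<bar> \<le> V * (err s * s ^ k\<^sub>0) * (1/2) ^ k" for k
    proof (cases "k = k\<^sub>0")
      case False
      have "\<bar>v k - v k\<^sub>0\<bar> \<le> V * (1 + \<bar>v k\<bar>)"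
        using mult_nonneg_nonneg[of "\<bar>v k\<^sub>0\<bar>" "\<bar>v k\<bar>"]
        unfolding V_def distrib_left distrib_right by linarith
      moreover have "s ^ k * exp (- infdist x (A k) / s) \<le> err s * s ^ k\<^sub>0"
      proof (cases "k < k\<^sub>0")
        case True
        \<comment> \<open>Moving from \<open>b\<close> to \<open>x\<close> costs at most
          \<open>s < \<delta> / 2\<close> of the distance \<open>\<delta>\<close>.\<close>
        have "\<delta> / 2 \<le> infdist x (A k)"
          using infdist_triangle[of b "A k" x] \<delta>_le[OF True] x s by simp
        then have "exp (- infdist x (A k) / s) \<le> exp (- (\<delta> / 2) / s)"
          using s divide_right_mono[of "\<delta> / 2" "infdist x (A k)" s] by simp
        moreover have "s ^ k \<le> 1" using s by (intro power_le_one) auto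
        ultimately have "s ^ k * exp (- infdist x (A k) / s) \<le> 1 * exp (- (\<delta> / 2) / s)"
          using s by (intro mult_mono) auto
        then show ?thesis unfolding err using s by (simp add: add_increasing)
      next
        case False
        with \<open>k \<noteq> k\<^sub>0\<close> have "s ^ k \<le> s ^ Suc k\<^sub>0"
          using s by (intro power_decreasing) auto
        moreover have "exp (- infdist x (A k) / s) \<le> 1"
          using s by (simp add: infdist_nonneg)
        ultimately have "s ^ k * exp (- infdist x (A k) / s) \<le> s ^ Suc k\<^sub>0 * 1"
          using s by (intro mult_mono) auto
        then show ?thesis unfolding err by (simp add: add_increasing2)
      qed
      ultimately show ?thesis
        using abs_weight_mult_le[of ?p "v k - v k\<^sub>0" V v k A] s by simp
    qed (use s \<open>V > 0\<close> in \<open>simp add: err_def\<close>)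
    have geo: "(\<lambda>k. V * (err s * s ^ k\<^sub>0) * (1/2) ^ k) sums (V * (err s * s ^ k\<^sub>0) * 2)"
      using geometric_sums[of "1/2::real"] by (intro sums_mult) simp
    \<comment> \<open>This sum over \<open>?W\<close> is the error
      \<open>weighted_average A v ?p - v k\<^sub>0\<close>.\<close>
    have sums: "(\<lambda>k. weight A v k ?p * (v k - v k\<^sub>0)) sums
        ((\<Sum>k. weight A v k ?p * v k) - ?W * v k\<^sub>0)"
      unfolding right_diff_distrib
      by (intro sums_diff sums_mult2 summable_sums summable_weight[OF p])
    have "\<bar>(\<Sum>k. weight A v k ?p * v k) - ?W * v k\<^sub>0\<bar> \<le> V * (err s * s ^ k\<^sub>0) * 2"
      using norm_suminf_le[OF _ sums_summable[OF geo], of "\<lambda>k. weight A v k ?p * (v k - v k\<^sub>0)"]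
        term_le by (simp add: sums_unique[OF sums, symmetric] sums_unique[OF geo, symmetric])
    also have "\<dots> = C * err s * (s ^ k\<^sub>0 / (exp 1 * 2 ^ k\<^sub>0 * V))"
      using \<open>V > 0\<close> by (simp add: C_def)
    also have "\<dots> \<le> C * err s * ?W"
      using W s \<open>V > 0\<close> by (intro mult_left_mono) (auto simp: C_def err_def)
    finally show ?thesis
      using suminf_weight_pos[OF p, of A v]
      by (simp add: weighted_average_def abs_le_iff field_simps)
  qed
  have "((\<lambda>s. C * err s) \<longlongrightarrow> 0) (at_right 0)"
    unfolding err_def using \<open>\<delta> > 0\<close>
    by (intro tendsto_mult_right_zero tendsto_add_zero exp_inverse_over_power_tendsto_0 tendsto_ident_at) auto
  from filterlim_compose[OF this filterlim_snd_vicinity[of b]]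
  have lim: "((\<lambda>p. C * err (snd p)) \<longlongrightarrow> 0) (vicinity b)" .
  have "\<forall>\<^sub>F p in vicinity b. norm (weighted_average A v p - v k\<^sub>0) \<le> C * err (snd p)"
    unfolding eventually_vicinity using bound \<open>\<delta> > 0\<close>
    by (intro exI[of _ "min 1 (\<delta> / 2)"]) auto
  from Lim_null_comparison[OF this lim] show ?thesis by (rule LIM_zero_cancel)
qed

section \<open>Closed covers from the Baire-1 property\<close>

text \<open>Rationals are dense, so the preimages of the balls of radius \<open>e\<close> around
  them cover \<open>B\<close>; each is a countable union of relatively closed sets, and all of these
  are enumerated together.\<close>

lemma baire1_on_closed_cover:
  assumes "baire1_on B f" "B \<noteq> {}" "e > 0"
  obtains A :: "nat \<Rightarrow> 'a::metric_space set" and v :: "nat \<Rightarrow> real"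
  where "\<And>k. closedin (top_of_set B) (A k)" "\<And>k. A k \<noteq> {}" "B \<subseteq> (\<Union>k. A k)"
    "\<And>k x. x \<in> A k \<Longrightarrow> \<bar>f x - v k\<bar> \<le> e"
proof -
  have "fsigma_in (top_of_set B) {b\<in>B. f b \<in> ball (of_rat q) e}" for q
    using assms(1) open_ball unfolding baire1_on_def by blast
  then have "\<forall>q. \<exists>\<U>. countable \<U> \<and> \<U> \<subseteq> Collect (closedin (top_of_set B)) \<and>
      \<Union>\<U> = {b\<in>B. f b \<in> ball (of_rat q) e}"
    by (simp add: fsigma_in_def union_of_def)
  from choice[OF this] obtain \<U> where "\<forall>q. countable (\<U> q) \<and>
      \<U> q \<subseteq> Collect (closedin (top_of_set B)) \<and> \<Union>(\<U> q) = {b\<in>B. f b \<in> ball (of_rat q) e}" ..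
  then have \<U>: "countable (\<U> q)" "C \<in> \<U> q \<Longrightarrow> closedin (top_of_set B) C"
    "\<Union>(\<U> q) = {b\<in>B. f b \<in> ball (of_rat q) e}" for q C
    by blast+
  \<comment> \<open>Each piece keeps its rational centre, the later value of \<open>v\<close>. Empty
    pieces are removed because \<open>infdist\<close> to the empty set is \<open>0\<close>, which
    would make them count as near.\<close>
  define S where "S = (SIGMA q:UNIV. \<U> q - {{}})"
  have cover: "\<exists>z\<in>S. b \<in> snd z" if "b \<in> B" for b
  proof -
    obtain q where "f b - e < of_rat q" "of_rat q < f b + e"
      using of_rat_dense[of "f b - e" "f b + e"] assms(3) by auto
    then have "b \<in> \<Union>(\<U> q)"
      using that by (auto simp: \<U>(3) dist_real_def)
    then show ?thesis by (force simp: S_def)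
  qed
  have "S \<noteq> {}" using cover assms(2) by blast
  have "countable S" unfolding S_def using \<U>(1) by (intro countable_SIGMA) auto
  have in_S: "from_nat_into S k \<in> S" for k
    using \<open>S \<noteq> {}\<close> by (rule from_nat_into)
  show thesis
  proof
    show "closedin (top_of_set B) (snd (from_nat_into S k))" "snd (from_nat_into S k) \<noteq> {}" for k
      using in_S[of k] \<U>(2) by (auto simp: S_def)
    show "B \<subseteq> (\<Union>k. snd (from_nat_into S k))"
    proof
      fix b assume "b \<in> B"
      then obtain z where "z \<in> S" "b \<in> snd z" using cover by blast
      then show "b \<in> (\<Union>k. snd (from_nat_into S k))"
        using from_nat_into_surj[OF \<open>countable S\<close>] by blast
    qed
    show "\<bar>f x - of_rat (fst (from_nat_into S k))\<bar> \<le> e" if x: "x \<in> snd (from_nat_into S k)" for k x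
    proof -
      have "x \<in> \<Union>(\<U> (fst (from_nat_into S k)))"
        using x in_S[of k] by (auto simp: S_def)
      then show ?thesis by (auto simp: \<U>(3) dist_real_def)
    qed
  qed
qed

lemma baire1_on_vicinity_limit:
  fixes f :: "'a::metric_space \<Rightarrow> real"
  assumes "baire1_on B f"
  shows "\<exists>G. continuous_on (UNIV \<times> {0<..1}) G \<and> (\<forall>b\<in>B. (G \<longlongrightarrow> f b) (vicinity b))"
proof (cases "B = {}")
  case False
  define good where "good m A v \<longleftrightarrow> (\<forall>k. closedin (top_of_set B) (A k) \<and> A k \<noteq> {}) \<and>
    B \<subseteq> (\<Union>k. A k) \<and> (\<forall>k. \<forall>x\<in>A k. \<bar>f x - v k\<bar> \<le> (1/2) ^ m)"
    for m :: nat and A :: "nat \<Rightarrow> 'a set" and v :: "nat \<Rightarrow> real"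
  have "\<exists>A v. good m A v" for m
  proof -
    obtain A and v :: "nat \<Rightarrow> real"
      where "\<And>k. closedin (top_of_set B) (A k)" "\<And>k. A k \<noteq> {}" "B \<subseteq> (\<Union>k. A k)"
        "\<And>k x. x \<in> A k \<Longrightarrow> \<bar>f x - v k\<bar> \<le> (1/2) ^ m"
      using baire1_on_closed_cover[OF assms False, of "(1/2) ^ m"] by auto
    then show ?thesis unfolding good_def by blast
  qed
  then obtain A v where good: "\<And>m. good m (A m) (v m)" by metis
  have closed: "closedin (top_of_set B) (A m k)" and ne: "A m k \<noteq> {}"
    and cover: "B \<subseteq> (\<Union>k. A m k)"
    and close: "x \<in> A m k \<Longrightarrow> \<bar>f x - v m k\<bar> \<le> (1/2) ^ m" for m k x
    using good[of m] unfolding good_def by blast+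
  \<comment> \<open>The pieces may overlap; the least index ensures that \<open>b\<close> avoids all
    earlier ones.\<close>
  define k\<^sub>0 where "k\<^sub>0 m b = (LEAST k. b \<in> A m k)" for m b
  have k\<^sub>0: "b \<in> A m (k\<^sub>0 m b)" if "b \<in> B" for m b
    unfolding k\<^sub>0_def using cover[of m] that by (auto intro: LeastI)
  show ?thesis
  proof (rule uniform_limit_of_limits[where G = "\<lambda>m. weighted_average (A m) (v m)"
        and h = "\<lambda>m b. v m (k\<^sub>0 m b)"])
    show "(weighted_average (A m) (v m) \<longlongrightarrow> v m (k\<^sub>0 m b)) (vicinity b)" if b: "b \<in> B" for m b
    proof (rule weighted_average_tendsto)
      show "infdist b (A m k) > 0" if "k < k\<^sub>0 m b" for k
      proof -
        have "b \<notin> A m k" using that not_less_Least unfolding k\<^sub>0_def by blast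
        \<comment> \<open>\<open>A m k\<close> is closed only in \<open>B\<close>, but
          \<open>b\<close> lies in \<open>B\<close>, so \<open>b\<close> also avoids the closure in
          the whole type.\<close>
        moreover obtain T where "closed T" "A m k = B \<inter> T"
          using closed[of m k] by (auto simp: closedin_closed)
        ultimately have "b \<notin> closure (A m k)"
          using b closure_minimal[of "A m k" T] by blast
        then show ?thesis
          using in_closure_iff_infdist_zero[OF ne] infdist_nonneg[of b "A m k"] by (metis less_le)
      qed
    qed (rule k\<^sub>0[OF b])
    show "\<bar>v m (k\<^sub>0 m b) - f b\<bar> \<le> (1/2) ^ m" if "b \<in> B" for m b
      using close[OF k\<^sub>0[OF that]] by (simp add: abs_minus_commute)
  qed (rule continuous_on_weighted_average)
\<comment> \<open>An empty \<open>B\<close> has no nonempty subsets to cover it with, but then any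
  constant \<open>G\<close> serves.\<close>
qed (auto intro: continuous_on_const)

section \<open>Gauges and their limits\<close>

lemma gauge_rep_majorant:
  assumes "gauge_rep \<phi>"
  obtains r where "continuous_on {0<..} r" "\<And>t. t > 0 \<Longrightarrow> 0 < r t \<and> r t \<le> 1"
    "(r \<longlongrightarrow> 0) (at_right 0)" "\<forall>\<^sub>F t in at_right 0. \<phi> t \<le> r t"
proof -
  obtain \<epsilon> where \<epsilon>: "\<epsilon> > 0" "continuous_on {0..<\<epsilon>} \<phi>" "\<And>x. x \<in> {0..<\<epsilon>} \<Longrightarrow> 0 \<le> \<phi> x"
    and "\<phi> 0 = 0"
    using assms unfolding gauge_rep_def by blast
  \<comment> \<open>Cutting the argument off at \<open>\<epsilon> / 2\<close> stays where
    \<open>\<phi>\<close> is controlled, adding \<open>t\<close> gives positivity, and the cap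
    \<open>1\<close> keeps \<open>r t\<close> in the range where the averages are
    continuous.\<close>
  define r where "r t = min 1 (\<phi> (min t (\<epsilon> / 2)) + t)" for t
  have cont: "continuous_on {0..} r"
    unfolding r_def using \<epsilon>(1)
    by (intro continuous_intros continuous_on_compose2[OF \<epsilon>(2)]) auto
  show thesis
  proof
    show "continuous_on {0<..} r" using cont by (rule continuous_on_subset) auto
    show "0 < r t \<and> r t \<le> 1" if "t > 0" for t
      using \<epsilon>(3)[of "min t (\<epsilon> / 2)"] \<epsilon>(1) that by (auto simp: r_def min_def)
    have "r 0 = 0" using \<open>\<phi> 0 = 0\<close> \<epsilon>(1) by (simp add: r_def)
    then have "(r \<longlongrightarrow> 0) (at 0 within {0..})"
      using cont[unfolded continuous_on_def, rule_format, of 0] by simp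
    then show lim: "(r \<longlongrightarrow> 0) (at_right 0)"
      by (rule tendsto_within_subset) auto
    \<comment> \<open>Near \<open>0\<close> neither cut-off is active, so
      \<open>r t = \<phi> t + t\<close>.\<close>
    have "\<forall>\<^sub>F t in at_right 0. r t < 1"
      using order_tendstoD(2)[OF lim, of 1] by simp
    moreover have "\<forall>\<^sub>F t in at_right 0. 0 < t \<and> t < \<epsilon> / 2"
      using \<epsilon>(1) by (auto simp: eventually_at_right_field intro: exI[of _ "\<epsilon> / 2"])
    ultimately show "\<forall>\<^sub>F t in at_right 0. \<phi> t \<le> r t"
      by eventually_elim (auto simp: r_def min_def split: if_splits)
  qed
qed

text \<open>Substituting \<open>s = r t\<close> turns \<open>dist b b' \<le> \<phi> t\<close> into
  membership in the cone for small \<open>t\<close>, as then \<open>\<phi> t \<le> r t\<close>; and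
  \<open>r t \<rightarrow> 0\<close>.\<close>

lemma baire1_on_imp_gauge_boundary_limit:
  fixes f :: "'a::metric_space \<Rightarrow> real"
  assumes "baire1_on B f"
  shows "\<exists>F. continuous_on (UNIV \<times> {0<..}) F \<and> gauge_boundary_limit \<phi> B UNIV F f"
  using assms
proof transfer
  fix \<phi> and B and f :: "'a \<Rightarrow> real"
  assume "germ_eq \<phi> \<phi>" and f: "baire1_on B f"
  from this(1) have "gauge_rep \<phi>" by (simp add: germ_eq_def)
  then obtain r where r: "continuous_on {0<..} r" "\<And>t. t > 0 \<Longrightarrow> 0 < r t \<and> r t \<le> 1"
    "(r \<longlongrightarrow> 0) (at_right 0)" "\<forall>\<^sub>F t in at_right 0. \<phi> t \<le> r t"
    by (rule gauge_rep_majorant) (rule that)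
  obtain G where G: "continuous_on (UNIV \<times> {0<..1}) G" "\<And>b. b \<in> B \<Longrightarrow> (G \<longlongrightarrow> f b) (vicinity b)"
    using baire1_on_vicinity_limit[OF f] by blast
  let ?F = "\<lambda>(x, t). G (x, r t)"
  have cont: "continuous_on (UNIV \<times> {0<..}) ?F"
  proof -
    have "continuous_on (UNIV \<times> {0<..}) (\<lambda>p::'a \<times> real. r (snd p))"
      by (rule continuous_on_compose2[OF r(1) continuous_on_snd[OF continuous_on_id]]) auto
    then have "continuous_on (UNIV \<times> {0<..}) (\<lambda>p::'a \<times> real. (fst p, r (snd p)))"
      by (intro continuous_on_Pair continuous_on_fst continuous_on_id)
    from continuous_on_compose2[OF G(1) this] show ?thesis
      using r(2) by (simp add: case_prod_unfold image_subset_iff)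
  qed
  have lim: "\<exists>\<delta>>0. \<forall>t. 0 < t \<and> t < \<delta> \<longrightarrow>
      (\<forall>b'\<in>UNIV. dist b b' \<le> \<phi> t \<longrightarrow> \<bar>?F (b', t) - f b\<bar> < \<eta>)" if b: "b \<in> B" "\<eta> > 0" for b \<eta>
  proof -
    obtain \<delta> where \<delta>: "\<delta> > 0"
      "\<And>s x. 0 < s \<Longrightarrow> s < \<delta> \<Longrightarrow> dist b x \<le> s \<Longrightarrow> \<bar>G (x, s) - f b\<bar> < \<eta>"
      using tendstoD[OF G(2)[OF b(1)] b(2)] unfolding eventually_vicinity dist_real_def by blast
    have "\<forall>\<^sub>F t in at_right 0. r t < \<delta> \<and> \<phi> t \<le> r t"
      using order_tendstoD(2)[OF r(3) \<delta>(1)] r(4) by eventually_elim simp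
    then obtain \<delta>' where "\<delta>' > 0" "\<And>t. 0 < t \<Longrightarrow> t < \<delta>' \<Longrightarrow> r t < \<delta> \<and> \<phi> t \<le> r t"
      unfolding eventually_at_right_field by auto
    then show ?thesis
      using \<delta>(2) r(2) by (intro exI[of _ \<delta>']) (auto intro: order_trans)
  qed
  show "\<exists>F. continuous_on (UNIV \<times> {0<..}) F \<and> (\<forall>b\<in>B. \<forall>\<eta>>0. \<exists>\<delta>>0. \<forall>t. 0 < t \<and> t < \<delta> \<longrightarrow>
      (\<forall>b'\<in>UNIV. dist b b' \<le> \<phi> t \<longrightarrow> \<bar>F (b', t) - f b\<bar> < \<eta>))"
    using cont lim by (intro exI[of _ ?F]) blast
qed

text \<open>A smaller gauge or carrier leaves fewer points \<open>b'\<close> to control. This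
  reduces a bounded family to one upper bound and every carrier to \<open>UNIV\<close>.\<close>

lemma gauge_boundary_limit_mono:
  assumes "gauge_boundary_limit \<psi> B B' F f" "\<phi> \<le> \<psi>" "C \<subseteq> B'"
  shows "gauge_boundary_limit \<phi> B C F f"
  using assms
proof transfer
  fix \<phi> \<psi> :: "real \<Rightarrow> real" and B B' C :: "'a set" and F and f :: "'a \<Rightarrow> real"
  assume lim: "\<forall>b\<in>B. \<forall>\<eta>>0. \<exists>\<delta>>0. \<forall>t. 0 < t \<and> t < \<delta> \<longrightarrow>
      (\<forall>b'\<in>B'. dist b b' \<le> \<psi> t \<longrightarrow> \<bar>F (b', t) - f b\<bar> < \<eta>)"
    and le: "\<exists>\<epsilon>>0. \<forall>x\<in>{0..<\<epsilon>}. \<phi> x \<le> \<psi> x" and sub: "C \<subseteq> B'"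
  show "\<forall>b\<in>B. \<forall>\<eta>>0. \<exists>\<delta>>0. \<forall>t. 0 < t \<and> t < \<delta> \<longrightarrow>
      (\<forall>b'\<in>C. dist b b' \<le> \<phi> t \<longrightarrow> \<bar>F (b', t) - f b\<bar> < \<eta>)"
  proof (intro ballI allI impI)
    fix b \<eta> assume "b \<in> B" "(\<eta>::real) > 0"
    then obtain \<delta> where \<delta>: "\<delta> > 0" "\<And>t b'. 0 < t \<Longrightarrow> t < \<delta> \<Longrightarrow> b' \<in> B' \<Longrightarrow> dist b b' \<le> \<psi> t
        \<Longrightarrow> \<bar>F (b', t) - f b\<bar> < \<eta>"
      using lim by metis
    obtain \<epsilon> where "\<epsilon> > 0" "\<And>x. 0 \<le> x \<Longrightarrow> x < \<epsilon> \<Longrightarrow> \<phi> x \<le> \<psi> x"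
      using le by auto
    with \<delta> sub show "\<exists>\<delta>>0. \<forall>t. 0 < t \<and> t < \<delta> \<longrightarrow>
        (\<forall>b'\<in>C. dist b b' \<le> \<phi> t \<longrightarrow> \<bar>F (b', t) - f b\<bar> < \<eta>)"
      by (intro exI[of _ "min \<delta> \<epsilon>"]) (auto, meson less_imp_le order_trans subsetD)
  qed
qed

lemma gauge_boundary_limit_imp_gauge_limit:
  assumes "gauge_boundary_limit \<phi> B B' F f"
  shows "gauge_limit \<phi> B B' (\<lambda>n x. F (x, 1 / real n)) f"
  using assms
proof transfer
  fix \<phi> :: "real \<Rightarrow> real" and B B' :: "'a set" and F and f :: "'a \<Rightarrow> real"
  assume lim: "\<forall>b\<in>B. \<forall>\<eta>>0. \<exists>\<delta>>0. \<forall>t. 0 < t \<and> t < \<delta> \<longrightarrow>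
      (\<forall>b'\<in>B'. dist b b' \<le> \<phi> t \<longrightarrow> \<bar>F (b', t) - f b\<bar> < \<eta>)"
  show "\<forall>b\<in>B. \<forall>\<eta>>0. \<exists>N\<ge>1. \<forall>n\<ge>N.
      (\<forall>b'\<in>B'. dist b b' \<le> \<phi> (1 / real n) \<longrightarrow> \<bar>F (b', 1 / real n) - f b\<bar> < \<eta>)"
  proof (intro ballI allI impI)
    fix b \<eta> assume "b \<in> B" "(\<eta>::real) > 0"
    then obtain \<delta> where \<delta>: "\<delta> > 0" "\<And>t b'. 0 < t \<Longrightarrow> t < \<delta> \<Longrightarrow> b' \<in> B' \<Longrightarrow> dist b b' \<le> \<phi> t
        \<Longrightarrow> \<bar>F (b', t) - f b\<bar> < \<eta>"
      using lim by metis
    obtain N where N: "inverse (real (Suc N)) < \<delta>"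
      using reals_Archimedean[OF \<delta>(1)] by blast
    have "1 / real n < \<delta>" if "n \<ge> Suc N" for n
      using N that frac_le[of 1 1 "real (Suc N)" "real n"] by (simp add: inverse_eq_divide)
    \<comment> \<open>The witness \<open>Suc N\<close> keeps \<open>1 / real n\<close> positive; at
      \<open>n = 0\<close> it would be \<open>0\<close>.\<close>
    then show "\<exists>N\<ge>1. \<forall>n\<ge>N.
        (\<forall>b'\<in>B'. dist b b' \<le> \<phi> (1 / real n) \<longrightarrow> \<bar>F (b', 1 / real n) - f b\<bar> < \<eta>)"
      using \<delta>(2) by (intro exI[of _ "Suc N"]) auto
  qed
qed

text \<open>The choice \<open>b' = b\<close> is admissible once
  \<open>0 \<le> \<phi> (1 / real n)\<close>; a representative is known to be nonnegative only near
  \<open>0\<close>, hence for large \<open>n\<close>.\<close>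

lemma gauge_limit_imp_tendsto:
  assumes "gauge_limit \<phi> B B' F f" "b \<in> B" "B \<subseteq> B'"
  shows "(\<lambda>n. F n b) \<longlonglongrightarrow> f b"
  using assms
proof transfer
  fix \<phi> :: "real \<Rightarrow> real" and B B' :: "'a set" and F and f :: "'a \<Rightarrow> real" and b
  assume "germ_eq \<phi> \<phi>"
    and lim: "\<forall>b\<in>B. \<forall>\<eta>>0. \<exists>N\<ge>1. \<forall>n\<ge>N.
      (\<forall>b'\<in>B'. dist b b' \<le> \<phi> (1 / real n) \<longrightarrow> \<bar>F n b' - f b\<bar> < \<eta>)"
    and b: "b \<in> B" "B \<subseteq> B'"
  from \<open>germ_eq \<phi> \<phi>\<close> obtain \<epsilon> where \<epsilon>: "\<epsilon> > 0" "\<And>x. x \<in> {0..<\<epsilon>} \<Longrightarrow> 0 \<le> \<phi> x"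
    unfolding germ_eq_def gauge_rep_def by blast
  have "\<forall>\<^sub>F n in sequentially. 1 / real n < \<epsilon>"
    using order_tendstoD(2)[OF lim_1_over_n \<epsilon>(1)] by simp
  then have nonneg: "\<forall>\<^sub>F n in sequentially. 0 \<le> \<phi> (1 / real n)"
    by eventually_elim (simp add: \<epsilon>(2))
  show "(\<lambda>n. F n b) \<longlonglongrightarrow> f b"
  proof (rule tendstoI)
    fix \<eta> :: real assume "\<eta> > 0"
    then obtain N where "\<And>n b'. n \<ge> N \<Longrightarrow> b' \<in> B' \<Longrightarrow> dist b b' \<le> \<phi> (1 / real n) \<Longrightarrow> \<bar>F n b' - f b\<bar> < \<eta>"
      using lim b by metis
    then have close: "dist (F n b) (f b) < \<eta>" if "n \<ge> N" "0 \<le> \<phi> (1 / real n)" for n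
      using b that by (simp add: dist_real_def subset_iff)
    show "\<forall>\<^sub>F n in sequentially. dist (F n b) (f b) < \<eta>"
      using eventually_ge_at_top[of N] nonneg by eventually_elim (rule close)
  qed
qed

section \<open>From Baire-1 to the limit conditions and back\<close>

text \<open>One upper bound \<open>\<psi>\<close> of the family yields a single \<open>F\<close> on
  the whole type, which is then restricted to \<open>B'\<close>.\<close>

lemma continuous_boundary_limit_if_baire1_on:
  assumes "baire1_on B f" "bdd_above \<Phi>"
  shows "continuous_boundary_limit \<Phi> B B' f"
proof -
  obtain \<psi> where \<psi>: "\<And>\<phi>. \<phi> \<in> \<Phi> \<Longrightarrow> \<phi> \<le> \<psi>"
    using assms(2) unfolding bdd_above_def by blast
  obtain F where F: "continuous_on (UNIV \<times> {0<..}) F" "gauge_boundary_limit \<psi> B UNIV F f"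
    using baire1_on_imp_gauge_boundary_limit[OF assms(1)] by blast
  show ?thesis
    unfolding continuous_boundary_limit_def family_boundary_limit_def
    using continuous_on_subset[OF F(1), of "B' \<times> {0<..}"] gauge_boundary_limit_mono[OF F(2) \<psi>]
    by (intro exI[of _ F]) auto
qed

lemma continuous_sequence_limit_if_boundary_limit:
  assumes "continuous_boundary_limit \<Phi> B B' f"
  shows "continuous_sequence_limit \<Phi> B B' f"
proof -
  obtain F where F: "continuous_on (B' \<times> {0<..}) F" "\<And>\<phi>. \<phi> \<in> \<Phi> \<Longrightarrow> gauge_boundary_limit \<phi> B B' F f"
    using assms unfolding continuous_boundary_limit_def family_boundary_limit_def by blast
  have "continuous_on B' (\<lambda>x. F (x, 1 / real n))" if "n \<ge> 1" for n
    using that by (intro continuous_on_compose2[OF F(1)] continuous_intros) auto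
  then show ?thesis
    unfolding continuous_sequence_limit_def family_limit_def
    using gauge_boundary_limit_imp_gauge_limit[OF F(2)]
    by (intro exI[of _ "\<lambda>n x. F (x, 1 / real n)"]) auto
qed

lemma relatively_baire1_if_continuous_sequence_limit:
  assumes "continuous_sequence_limit \<Phi> B B' f" "\<Phi> \<noteq> {}" "B \<subseteq> B'"
  shows "relatively_baire1 B B' f"
proof -
  obtain \<phi> F where F: "\<And>n. n \<ge> 1 \<Longrightarrow> continuous_on B' (F n)" "gauge_limit \<phi> B B' F f"
    using assms(1,2) unfolding continuous_sequence_limit_def family_limit_def by blast
  \<comment> \<open>\<open>relatively_baire1\<close> asks for continuity at every index, but
    \<open>F 0\<close> is unconstrained, so the sequence is shifted by one.\<close>
  show ?thesis
    unfolding relatively_baire1_def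
    using F(1) LIMSEQ_Suc[OF gauge_limit_imp_tendsto[OF F(2) _ assms(3)]]
    by (intro exI[of _ "\<lambda>n. F (Suc n)"]) auto
qed

text \<open>An open \<open>U\<close> is exhausted by the closed sets \<open>K m\<close> of points at
  distance at least \<open>1 / (m + 1)\<close> from its complement. So \<open>f b\<close> lies in
  \<open>U\<close> iff for some \<open>m\<close> all but finitely many \<open>F n b\<close> lie in
  \<open>K m\<close>, which writes the preimage as a countable union of closed sets.\<close>

lemma baire1_on_if_relatively_baire1:
  assumes "relatively_baire1 B B' f" "B \<subseteq> B'"
  shows "baire1_on B f"
  unfolding baire1_on_def
proof (intro allI impI)
  fix U :: "real set" assume "open U"
  obtain F where F: "\<And>n. continuous_on B (F n)" "\<And>b. b \<in> B \<Longrightarrow> (\<lambda>n. F n b) \<longlonglongrightarrow> f b"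
    using assms unfolding relatively_baire1_def by (meson continuous_on_subset)
  \<comment> \<open>The quantified form makes \<open>K m\<close> the whole line when
    \<open>U = UNIV\<close>, where \<open>infdist\<close> to the empty complement would be
    \<open>0\<close>.\<close>
  define K where "K m = {y. \<forall>z\<in>-U. 1 / real (Suc m) \<le> dist y z}" for m
  have closed: "closed (K m)" for m
    unfolding K_def Ball_def by (intro closed_Collect_all closed_Collect_imp closed_Collect_le
        open_Collect_const continuous_intros)
  have closedin: "closedin (top_of_set B) (\<Inter>n\<in>{N..}. B \<inter> F n -` K m)" for m N
    by (intro closedin_INT continuous_closedin_preimage F(1) closed) auto
  have "\<exists>m N. \<forall>n\<ge>N. F n b \<in> K m" if b: "b \<in> B" "f b \<in> U" for b
  proof -
    \<comment> \<open>Half of the margin \<open>e\<close> absorbs \<open>dist (F n b) (f b)\<close>,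
      the other half leaves room for \<open>1 / (m + 1)\<close>.\<close>
    obtain e where e: "e > 0" "ball (f b) e \<subseteq> U"
      using \<open>open U\<close> b(2) by (auto simp: open_contains_ball)
    obtain m where m: "inverse (real (Suc m)) < e / 2"
      using reals_Archimedean[of "e / 2"] e(1) by auto
    obtain N where N: "\<And>n. n \<ge> N \<Longrightarrow> dist (F n b) (f b) < e / 2"
      using metric_LIMSEQ_D[OF F(2)[OF b(1)], of "e / 2"] e(1) by auto
    have "F n b \<in> K m" if "n \<ge> N" for n
    proof -
      have "1 / real (Suc m) \<le> dist (F n b) z" if "z \<notin> U" for z
      proof -
        have "e \<le> dist (f b) z" using e(2) that by (meson mem_ball not_less subsetD)
        then show ?thesis
          using N[OF \<open>n \<ge> N\<close>] m dist_triangle[of "f b" z "F n b"]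
          by (simp add: dist_commute inverse_eq_divide)
      qed
      then show ?thesis by (simp add: K_def)
    qed
    then show ?thesis by blast
  qed
  moreover have "f b \<in> U" if b: "b \<in> B" "\<forall>n\<ge>N. F n b \<in> K m" for b m N
  proof -
    have "f b \<in> K m"
      using b(2) by (intro Lim_in_closed_set[OF closed _ _ F(2)[OF b(1)]])
        (auto simp: eventually_sequentially)
    \<comment> \<open>Otherwise \<open>z = f b\<close> would put \<open>f b\<close> at positive
      distance from itself.\<close>
    then show ?thesis by (force simp: K_def)
  qed
  ultimately have "{b\<in>B. f b \<in> U} = (\<Union>(m, N). \<Inter>n\<in>{N..}. B \<inter> F n -` K m)"
    by fastforce
  also have "fsigma_in (top_of_set B) \<dots>"
    using closedin by (intro fsigma_in_Union) (auto intro: closed_imp_fsigma_in)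
  finally show "fsigma_in (top_of_set B) {b\<in>B. f b \<in> U}" .
qed

section \<open>Equivalence of all conditions\<close>

text \<open>For a fixed nonempty bounded family the implications form a cycle: Baire-1, boundary
  limit, sequence limit, relatively Baire-1, Baire-1. Each such family alone thus characterizes
  Baire-1, so "some" and "all" agree.\<close>

lemma relative_conditions_iff_baire1_on:
  assumes "B \<subseteq> B'"
  shows
    "some_bounded_family (\<lambda>\<Phi>. continuous_boundary_limit \<Phi> B B' f) \<longleftrightarrow> baire1_on B f"
    "all_bounded_families (\<lambda>\<Phi>. continuous_boundary_limit \<Phi> B B' f) \<longleftrightarrow> baire1_on B f"
    "(\<exists>\<phi>. continuous_boundary_limit {\<phi>} B B' f) \<longleftrightarrow> baire1_on B f"
    "(\<forall>\<phi>. continuous_boundary_limit {\<phi>} B B' f) \<longleftrightarrow> baire1_on B f"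
    "some_bounded_family (\<lambda>\<Phi>. continuous_sequence_limit \<Phi> B B' f) \<longleftrightarrow> baire1_on B f"
    "all_bounded_families (\<lambda>\<Phi>. continuous_sequence_limit \<Phi> B B' f) \<longleftrightarrow> baire1_on B f"
    "(\<exists>\<phi>. continuous_sequence_limit {\<phi>} B B' f) \<longleftrightarrow> baire1_on B f"
    "(\<forall>\<phi>. continuous_sequence_limit {\<phi>} B B' f) \<longleftrightarrow> baire1_on B f"
    "relatively_baire1 B B' f \<longleftrightarrow> baire1_on B f"
proof -
  have singleton: "{\<phi>} \<noteq> {}" "bdd_above {\<phi>}" for \<phi> :: smallness_gauge
    by (auto intro: bdd_aboveI[of _ \<phi>])
  have to_baire1: "baire1_on B f" if "continuous_sequence_limit \<Phi> B B' f" "\<Phi> \<noteq> {}" for \<Phi>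
    using that assms
    by (intro baire1_on_if_relatively_baire1 relatively_baire1_if_continuous_sequence_limit)
  note from_baire1 = continuous_boundary_limit_if_baire1_on[of B f _ B']
  note to_sequence = continuous_sequence_limit_if_boundary_limit[of _ B B' f]
  have boundary: "continuous_boundary_limit \<Phi> B B' f \<longleftrightarrow> baire1_on B f"
    if "\<Phi> \<noteq> {}" "bdd_above \<Phi>" for \<Phi>
    using to_baire1[OF to_sequence that(1)] from_baire1[OF _ that(2)] by (rule iffI)
  have sequence: "continuous_sequence_limit \<Phi> B B' f \<longleftrightarrow> baire1_on B f"
    if "\<Phi> \<noteq> {}" "bdd_above \<Phi>" for \<Phi>
    using to_baire1[OF _ that(1)] to_sequence[OF from_baire1[OF _ that(2)]] by (rule iffI)
  show "some_bounded_family (\<lambda>\<Phi>. continuous_boundary_limit \<Phi> B B' f) \<longleftrightarrow> baire1_on B f"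
    unfolding some_bounded_family_def using boundary singleton by metis
  show "some_bounded_family (\<lambda>\<Phi>. continuous_sequence_limit \<Phi> B B' f) \<longleftrightarrow> baire1_on B f"
    unfolding some_bounded_family_def using sequence singleton by metis
  \<comment> \<open>The empty family is bounded too; for it only the direction from Baire-1 is
    available, and the converse comes from a singleton.\<close>
  show "all_bounded_families (\<lambda>\<Phi>. continuous_boundary_limit \<Phi> B B' f) \<longleftrightarrow> baire1_on B f"
    unfolding all_bounded_families_def using boundary singleton from_baire1 by metis
  show "all_bounded_families (\<lambda>\<Phi>. continuous_sequence_limit \<Phi> B B' f) \<longleftrightarrow> baire1_on B f"
    unfolding all_bounded_families_def using sequence singleton from_baire1 to_sequence by metis
  show "(\<exists>\<phi>. continuous_boundary_limit {\<phi>} B B' f) \<longleftrightarrow> baire1_on B f"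
    "(\<forall>\<phi>. continuous_boundary_limit {\<phi>} B B' f) \<longleftrightarrow> baire1_on B f"
    "(\<exists>\<phi>. continuous_sequence_limit {\<phi>} B B' f) \<longleftrightarrow> baire1_on B f"
    "(\<forall>\<phi>. continuous_sequence_limit {\<phi>} B B' f) \<longleftrightarrow> baire1_on B f"
    by (simp_all add: boundary[OF singleton] sequence[OF singleton])
  show "relatively_baire1 B B' f \<longleftrightarrow> baire1_on B f"
    using baire1_on_if_relatively_baire1[OF _ assms] sequence[OF singleton]
      relatively_baire1_if_continuous_sequence_limit[OF _ singleton(1) assms] by metis
qed

text \<open>The absolute conditions are the relative ones with \<open>B' = B\<close>, so one lemma
  gives both halves.\<close>

theorem theorem2p5:
  fixes B B' :: "'a::metric_space set" and f :: "'a \<Rightarrow> real"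
  assumes "B \<subseteq> B'"
  shows
    "(some_bounded_family (\<lambda>\<Phi>. continuous_boundary_limit \<Phi> B B f) \<longleftrightarrow> baire1_on B f) \<and>
     (all_bounded_families (\<lambda>\<Phi>. continuous_boundary_limit \<Phi> B B f) \<longleftrightarrow> baire1_on B f) \<and>
     ((\<exists>\<phi>. continuous_boundary_limit {\<phi>} B B f) \<longleftrightarrow> baire1_on B f) \<and>
     ((\<forall>\<phi>. continuous_boundary_limit {\<phi>} B B f) \<longleftrightarrow> baire1_on B f) \<and>
     (some_bounded_family (\<lambda>\<Phi>. continuous_sequence_limit \<Phi> B B f) \<longleftrightarrow> baire1_on B f) \<and>
     (all_bounded_families (\<lambda>\<Phi>. continuous_sequence_limit \<Phi> B B f) \<longleftrightarrow> baire1_on B f) \<and>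
     ((\<exists>\<phi>. continuous_sequence_limit {\<phi>} B B f) \<longleftrightarrow> baire1_on B f) \<and>
     ((\<forall>\<phi>. continuous_sequence_limit {\<phi>} B B f) \<longleftrightarrow> baire1_on B f) \<and>
     (some_bounded_family (\<lambda>\<Phi>. continuous_boundary_limit \<Phi> B B' f) \<longleftrightarrow> baire1_on B f) \<and>
     (all_bounded_families (\<lambda>\<Phi>. continuous_boundary_limit \<Phi> B B' f) \<longleftrightarrow> baire1_on B f) \<and>
     ((\<exists>\<phi>. continuous_boundary_limit {\<phi>} B B' f) \<longleftrightarrow> baire1_on B f) \<and>
     ((\<forall>\<phi>. continuous_boundary_limit {\<phi>} B B' f) \<longleftrightarrow> baire1_on B f) \<and>
     (some_bounded_family (\<lambda>\<Phi>. continuous_sequence_limit \<Phi> B B' f) \<longleftrightarrow> baire1_on B f) \<and>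
     (all_bounded_families (\<lambda>\<Phi>. continuous_sequence_limit \<Phi> B B' f) \<longleftrightarrow> baire1_on B f) \<and>
     ((\<exists>\<phi>. continuous_sequence_limit {\<phi>} B B' f) \<longleftrightarrow> baire1_on B f) \<and>
     ((\<forall>\<phi>. continuous_sequence_limit {\<phi>} B B' f) \<longleftrightarrow> baire1_on B f) \<and>
     (relatively_baire1 B B' f \<longleftrightarrow> baire1_on B f)"
  using relative_conditions_iff_baire1_on[OF order_refl, of B f]
    relative_conditions_iff_baire1_on[OF assms, of f]
  by (intro conjI)

end
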